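(* Let $E$ be an AL-space and let $\mathcal{T} = (T_t)_{t \in J}$ be a bounded positive semigroup on $E$, where either $J = \mathbb{N}$ or $J = (0,\infty)$. Assume that every operator $T_t$ is a lattice homomorphism. Then the following assertions are equivalent: (i) $\mathcal{T}$ converges strongly (as $t\to\infty$) to an operator $P$ that fulfils $Pf>0$ for every $f > 0$. (ii) We have $T_t = \mathrm{id}_E$ for all $t \in J$. (iii) For every $0<f \in E$ there exists a non-zero lower bound $h_f$ for $(\mathcal{T},f)$.
   Context: All spaces are real. $\mathbb{N} = \{1,2,\dots\}$. An AL-space is a Banach lattice $E$ with $\|f+g\| = \|f\|+\|g\|$ for all $f,g \in E_+$, where $E_+$ is the positive cone. $f>0$ means $f\ge 0$ and $f \ne 0$. $\mathrm{id}_E$ is the identity operator. A semigroup on $E$ is a family $(T_t)_{t \in J}$ of bounded linear operators on $E$ with $T_{t+s} = T_tT_s$ for all $s,t \in J$; no continuity in $t$ is assumed. It is bounded if $\sup_{t\in J}\|T_t\|<\infty$, and positive if $T_tE_+\subseteq E_+$ for all $t \in J$. Strong convergence means convergence in the strong operator topology to a bounded linear operator. For $f \in E_+$, a lower bound for $(\mathcal{T},f)$ is a vector $h_f \in E_+$ such that $\lim_{t\to\infty}\|(T_tf-h_f)^-\| = 0$; here $g^- = (-g)\vee 0$. *)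

theory Defs
  imports "HOL-Analysis.Analysis" "HOL-Library.Lattice_Algebras"
begin

class banach_lattice = banach + ordered_real_vector + lattice_ab_group_add_abs +
  assumes norm_lattice_mono: "\<bar>x\<bar> \<le> \<bar>y\<bar> \<Longrightarrow> norm x \<le> norm y"

class al_space = banach_lattice +
  assumes norm_add_positive: "0 \<le> f \<Longrightarrow> 0 \<le> g \<Longrightarrow> norm (f + g) = norm f + norm g"

text \<open>Both time domains are regarded as subsets of the reals; the naturals start at 1.
  The values of a family outside its time domain \<open>J\<close> are irrelevant.\<close>

definition time_domain :: "real set \<Rightarrow> bool" where
  "time_domain J \<longleftrightarrow> J = real ` {1..} \<or> J = {0<..}"

definition time_limit :: "real set \<Rightarrow> real filter" where
  "time_limit J = inf at_top (principal J)"

definition op_semigroup ::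
    "real set \<Rightarrow> (real \<Rightarrow> 'a::real_normed_vector \<Rightarrow>\<^sub>L 'a) \<Rightarrow> bool" where
  "op_semigroup J T \<longleftrightarrow> (\<forall>s\<in>J. \<forall>t\<in>J. T (t + s) = T t o\<^sub>L T s)"

text \<open>Boundedness refers to the metric of the operator norm.\<close>

definition bounded_family ::
    "real set \<Rightarrow> (real \<Rightarrow> 'a::real_normed_vector \<Rightarrow>\<^sub>L 'a) \<Rightarrow> bool" where
  "bounded_family J T \<longleftrightarrow> bounded (T ` J)"

definition positive_family ::
    "real set \<Rightarrow> (real \<Rightarrow> 'a::banach_lattice \<Rightarrow>\<^sub>L 'a) \<Rightarrow> bool" where
  "positive_family J T \<longleftrightarrow> (\<forall>t\<in>J. \<forall>f\<ge>0. 0 \<le> T t f)"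

definition lattice_hom :: "('a::banach_lattice \<Rightarrow>\<^sub>L 'a) \<Rightarrow> bool" where
  "lattice_hom S \<longleftrightarrow> (\<forall>f g. S (sup f g) = sup (S f) (S g) \<and> S (inf f g) = inf (S f) (S g))"

definition converges_strongly ::
    "real set \<Rightarrow> (real \<Rightarrow> 'a::real_normed_vector \<Rightarrow>\<^sub>L 'a) \<Rightarrow> ('a \<Rightarrow>\<^sub>L 'a) \<Rightarrow> bool" where
  "converges_strongly J T P \<longleftrightarrow> (\<forall>f. ((\<lambda>t. T t f) \<longlongrightarrow> P f) (time_limit J))"

definition neg_part :: "'a::banach_lattice \<Rightarrow> 'a" where
  "neg_part g = sup (- g) 0"

definition lower_bound ::
    "real set \<Rightarrow> (real \<Rightarrow> 'a::banach_lattice \<Rightarrow>\<^sub>L 'a) \<Rightarrow> 'a \<Rightarrow> 'a \<Rightarrow> bool" where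
  "lower_bound J T f h \<longleftrightarrow>
     0 \<le> h \<and> ((\<lambda>t. norm (neg_part (T t f - h))) \<longlongrightarrow> 0) (time_limit J)"

end

theory Submission
  imports Defs
begin

text \<open>The substantial implication is that a semigroup of lattice homomorphisms with non-zero lower
  bounds is trivial; a limit operator that is strictly positive on \<open>f > 0\<close> supplies the lower bound
  \<open>P f\<close>, and the trivial semigroup converges to the identity.

  Fix \<open>f > 0\<close>. Its lower bounds form a norm bounded, norm closed set which is stable under finite
  suprema and under the semigroup. Additivity of the norm on the positive cone turns this into the
  existence of a largest lower bound \<open>h\<close> (\<open>al_space_greatest_element\<close>). The existence of
  non-zero lower bounds, used for \<open>h - T s h\<close>, \<open>(f - h)\<^sup>-\<close> and \<open>f - h\<close>, forces these vectors to be zero.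
  By maximality \<open>T s h \<le> h\<close>, and the orbit of \<open>h - T s h\<close> tends to zero because the norms along the
  orbit of \<open>h\<close> decrease to a limit; a positive vector whose orbit tends to zero has only the lower
  bound zero, so \<open>T s h = h\<close> (\<open>decreasing_orbit_fixed\<close>). The lattice homomorphism property makes the
  orbit of \<open>(f - h)\<^sup>-\<close> tend to zero, so \<open>h \<le> f\<close> by the same argument. Finally a non-zero lower bound of
  \<open>f - h\<close> could be added to \<open>h\<close>, contradicting maximality
  (\<open>lattice_hom_fixes_positive\<close>). Hence every positive vector is fixed, and by linearity every vector.\<close>

section \<open>Norm and order in AL-spaces\<close>

lemma norm_mono_positive:
  fixes x y :: "'a::banach_lattice"
  assumes "0 \<le> x" and "x \<le> y"
  shows "norm x \<le> norm y"
  using assms order_trans[OF assms] by (intro norm_lattice_mono) simp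

lemma norm_abs_eq_norm:
  fixes x :: "'a::banach_lattice"
  shows "norm \<bar>x\<bar> = norm x"
  by (intro antisym norm_lattice_mono) simp_all

lemma norm_pprt_le:
  fixes x e :: "'a::banach_lattice"
  assumes "x \<le> e" and "0 \<le> e"
  shows "norm (pprt x) \<le> norm e"
  using assms by (intro norm_mono_positive) (auto simp: pprt_def)

lemma norm_diff_ordered:
  fixes x y :: "'a::al_space"
  assumes "0 \<le> x" and "x \<le> y"
  shows "norm (y - x) = norm y - norm x"
  using norm_add_positive[of "y - x" x] assms by simp

text \<open>Closedness of the cone comes from monotonicity of the norm: if all \<open>x n\<close> are positive, then the
  negative part of \<open>l\<close> is dominated by \<open>\<bar>x n - l\<bar>\<close>.\<close>

lemma nonneg_tendsto:
  fixes x :: "nat \<Rightarrow> 'a::banach_lattice"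
  assumes lim: "x \<longlonglongrightarrow> l" and nonneg: "\<And>n. 0 \<le> x n"
  shows "0 \<le> l"
proof -
  have bound: "norm (pprt (- l)) \<le> norm (x n - l)" for n
  proof -
    have "- l \<le> x n - l" using nonneg[of n] by simp
    also have "\<dots> \<le> \<bar>x n - l\<bar>" by (rule abs_ge_self)
    finally have "norm (pprt (- l)) \<le> norm \<bar>x n - l\<bar>"
      by (rule norm_pprt_le) simp
    then show ?thesis by (simp add: norm_abs_eq_norm)
  qed
  have "(\<lambda>n. norm (x n - l)) \<longlonglongrightarrow> 0"
    using lim by (simp add: LIM_zero tendsto_norm_zero)
  then have "norm (pprt (- l)) \<le> 0"
    by (rule LIMSEQ_le_const) (use bound in auto)
  then have "pprt (- l) = 0" by simp
  then show "0 \<le> l" using pprt_eq_0[of "- l"] by (metis neg_0_le_iff_le neg_le_0_iff_le le_iff_sup pprt_def)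
qed

text \<open>The norm is additive on the cone, so along an increasing sequence of positive elements
  distances are differences of norms, and an increasing sequence in \<open>L\<close> whose norms tend to their
  supremum over \<open>L\<close> is Cauchy. Its limit has the largest norm in \<open>L\<close>; joining it with another
  member cannot increase the norm, and therefore changes nothing.\<close>

lemma al_space_greatest_element:
  fixes L :: "'a::al_space set"
  assumes ne: "L \<noteq> {}" and nonneg: "\<And>x. x \<in> L \<Longrightarrow> 0 \<le> x"
    and sup: "\<And>x y. x \<in> L \<Longrightarrow> y \<in> L \<Longrightarrow> sup x y \<in> L"
    and bdd: "bdd_above (norm ` L)"
    and closed: "\<And>x l. (\<And>n. x n \<in> L) \<Longrightarrow> x \<longlonglongrightarrow> l \<Longrightarrow> l \<in> L"
  obtains m where "m \<in> L" and "\<And>x. x \<in> L \<Longrightarrow> x \<le> m"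
proof -
  define c where "c = Sup (norm ` L)"
  have upper: "norm x \<le> c" if "x \<in> L" for x
    unfolding c_def using that bdd by (intro cSup_upper) auto
  have "\<exists>x\<in>L. c - 1 / real (Suc n) < norm x" for n
  proof -
    have "c - 1 / real (Suc n) < Sup (norm ` L)" by (simp add: c_def)
    then show ?thesis using less_cSup_iff[of "norm ` L"] ne bdd by auto
  qed
  then obtain h where h: "\<And>n. h n \<in> L" "\<And>n. c - 1 / real (Suc n) < norm (h n)"
    by metis
  define g where "g = rec_nat (h 0) (\<lambda>n z. sup z (h (Suc n)))"
  have g0: "g 0 = h 0" and gS: "g (Suc n) = sup (g n) (h (Suc n))" for n
    by (simp_all add: g_def)
  have gL: "g n \<in> L" for n
    by (induction n) (auto simp: g0 gS h sup)
  have hg: "h n \<le> g n" for n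
    by (cases n) (auto simp: g0 gS)
  have inc: "g n \<le> g m" if "n \<le> m" for n m
    using that by (rule lift_Suc_mono_le[rotated]) (simp add: gS)
  have lower: "c - 1 / real (Suc n) \<le> norm (g n)" for n
    using h(2)[of n] norm_mono_positive[OF nonneg[OF h(1)] hg, of n] by linarith
  have "(\<lambda>n. c - 1 / real (Suc n)) \<longlonglongrightarrow> c - 0"
    by (intro tendsto_intros LIMSEQ_Suc[OF lim_1_over_n])
  then have "(\<lambda>n. c - 1 / real (Suc n)) \<longlonglongrightarrow> c" by simp
  then have norms: "(\<lambda>n. norm (g n)) \<longlonglongrightarrow> c"
    by (rule tendsto_sandwich[OF _ _ _ tendsto_const, rotated 2])
      (use lower upper gL in simp_all)
  have dist: "norm (g i - g j) = \<bar>norm (g i) - norm (g j)\<bar>" for i j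
  proof (rule linorder_wlog[of "\<lambda>i j. norm (g i - g j) = \<bar>norm (g i) - norm (g j)\<bar>" i j])
    fix i j :: nat assume "i \<le> j"
    then have "norm (g j - g i) = norm (g j) - norm (g i)"
      using inc gL nonneg by (intro norm_diff_ordered) auto
    then show "norm (g i - g j) = \<bar>norm (g i) - norm (g j)\<bar>"
      by (metis abs_minus_commute abs_norm_cancel norm_minus_commute)
  qed (simp add: norm_minus_commute abs_minus_commute)
  have "Cauchy (\<lambda>n. norm (g n))"
    using norms by (rule LIMSEQ_imp_Cauchy)
  then have "Cauchy g"
    by (simp add: Cauchy_iff dist)
  then obtain m where m: "g \<longlonglongrightarrow> m"
    by (meson Cauchy_convergent convergent_def)
  have mL: "m \<in> L" using gL m by (rule closed)
  have norm_m: "norm m = c"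
    using tendsto_norm[OF m] norms by (rule LIMSEQ_unique)
  have "x \<le> m" if x: "x \<in> L" for x
  proof -
    have "norm (sup x m - m) = norm (sup x m) - norm m"
      using nonneg[OF mL] by (intro norm_diff_ordered) auto
    also have "\<dots> \<le> 0" using upper[OF sup[OF x mL]] norm_m by simp
    finally have "sup x m = m" by simp
    then show "x \<le> m" by (simp add: le_iff_sup)
  qed
  with mL show thesis by (rule that)
qed

section \<open>Lower bounds\<close>

lemma eventually_time_limit:
  "eventually P (time_limit J) \<longleftrightarrow> (\<exists>N. \<forall>t\<in>J. N \<le> t \<longrightarrow> P t)"
  by (auto simp: time_limit_def eventually_inf_principal eventually_at_top_linorder)

text \<open>Lower bounds are handled through error terms: a positive \<open>h\<close> is a lower bound exactly when it
  lies below the orbit up to a positive function that tends to zero. In this form most of their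
  properties reduce to adding inequalities or applying a positive operator to them.\<close>

lemma lower_boundI:
  fixes T :: "real \<Rightarrow> 'a::banach_lattice \<Rightarrow>\<^sub>L 'a"
  assumes "0 \<le> h" and e: "(e \<longlongrightarrow> 0) (time_limit J)"
    and le: "\<forall>\<^sub>F t in time_limit J. 0 \<le> e t \<and> h \<le> T t f + e t"
  shows "lower_bound J T f h"
proof -
  have "\<forall>\<^sub>F t in time_limit J. norm (neg_part (T t f - h)) \<le> norm (e t)"
    using le
  proof eventually_elim
    case (elim t)
    then have "h - T t f \<le> e t" by (simp add: diff_le_eq add.commute)
    with elim norm_pprt_le[of "h - T t f" "e t"] show ?case
      by (simp add: neg_part_def pprt_def)
  qed
  then have "((\<lambda>t. neg_part (T t f - h)) \<longlongrightarrow> 0) (time_limit J)"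
    using tendsto_norm_zero[OF e] by (rule Lim_null_comparison)
  then have "((\<lambda>t. norm (neg_part (T t f - h))) \<longlongrightarrow> 0) (time_limit J)"
    by (rule tendsto_norm_zero)
  with \<open>0 \<le> h\<close> show ?thesis by (simp add: lower_bound_def)
qed

lemma lower_boundE:
  fixes T :: "real \<Rightarrow> 'a::banach_lattice \<Rightarrow>\<^sub>L 'a"
  assumes "lower_bound J T f h"
  obtains e where "0 \<le> h" and "(e \<longlongrightarrow> 0) (time_limit J)"
    and "\<And>t. 0 \<le> e t" and "\<And>t. h \<le> T t f + e t"
proof
  let ?e = "\<lambda>t. neg_part (T t f - h)"
  show "0 \<le> h" using assms by (simp add: lower_bound_def)
  show "(?e \<longlongrightarrow> 0) (time_limit J)"
    using assms by (auto simp: lower_bound_def intro: tendsto_norm_zero_cancel)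
  show "0 \<le> ?e t" for t by (simp add: neg_part_def)
  have "- (T t f - h) \<le> ?e t" for t by (simp only: neg_part_def sup_ge1)
  then show "h \<le> T t f + ?e t" for t by (simp add: diff_le_eq add.commute)
qed

lemma lower_bound_limit:
  fixes T :: "real \<Rightarrow> 'a::banach_lattice \<Rightarrow>\<^sub>L 'a"
  assumes lim: "((\<lambda>t. T t f) \<longlongrightarrow> h) (time_limit J)" and "0 \<le> h"
  shows "lower_bound J T f h"
proof (rule lower_boundI)
  show "0 \<le> h" by fact
  show "((\<lambda>t. \<bar>T t f - h\<bar>) \<longlongrightarrow> 0) (time_limit J)"
    using tendsto_norm_zero[OF LIM_zero[OF lim]]
    by (intro tendsto_norm_zero_cancel[of "\<lambda>t. \<bar>T t f - h\<bar>"]) (simp add: norm_abs_eq_norm)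
  have "h \<le> T t f + \<bar>T t f - h\<bar>" for t
    using abs_ge_minus_self[of "T t f - h"] by (simp add: diff_le_eq add.commute)
  then show "\<forall>\<^sub>F t in time_limit J. 0 \<le> \<bar>T t f - h\<bar> \<and> h \<le> T t f + \<bar>T t f - h\<bar>"
    by simp
qed

lemma lower_bound_sup:
  fixes T :: "real \<Rightarrow> 'a::banach_lattice \<Rightarrow>\<^sub>L 'a"
  assumes "lower_bound J T f h" and "lower_bound J T f k"
  shows "lower_bound J T f (sup h k)"
proof -
  obtain d where d: "0 \<le> h" "(d \<longlongrightarrow> 0) (time_limit J)" "\<And>t. 0 \<le> d t" "\<And>t. h \<le> T t f + d t"
    using assms(1) by (rule lower_boundE) blast
  obtain e where e: "0 \<le> k" "(e \<longlongrightarrow> 0) (time_limit J)" "\<And>t. 0 \<le> e t" "\<And>t. k \<le> T t f + e t"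
    using assms(2) by (rule lower_boundE) blast
  show ?thesis
  proof (rule lower_boundI)
    show "0 \<le> sup h k" using d(1) by (simp add: le_supI1)
    show "((\<lambda>t. d t + e t) \<longlongrightarrow> 0) (time_limit J)"
      using tendsto_add[OF d(2) e(2)] by simp
    have "h \<le> T t f + (d t + e t)" "k \<le> T t f + (d t + e t)" for t
      using d(3,4)[of t] e(3,4)[of t] add_mono[OF d(4) e(3), of t t] add_mono[OF e(4) d(3), of t t]
      by (simp_all add: algebra_simps)
    then show "\<forall>\<^sub>F t in time_limit J. 0 \<le> d t + e t \<and> sup h k \<le> T t f + (d t + e t)"
      using d(3) e(3) by simp
  qed
qed

lemma lower_bound_tendsto:
  fixes T :: "real \<Rightarrow> 'a::banach_lattice \<Rightarrow>\<^sub>L 'a"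
  assumes lb: "\<And>n::nat. lower_bound J T f (h n)" and lim: "h \<longlonglongrightarrow> l"
  shows "lower_bound J T f l"
proof -
  have "0 \<le> h n" for n using lb by (simp add: lower_bound_def)
  then have "0 \<le> l" by (rule nonneg_tendsto[OF lim])
  have "\<forall>\<^sub>F t in time_limit J. norm (neg_part (T t f - l)) < r" if "0 < r" for r :: real
  proof -
    have "\<forall>\<^sub>F n in sequentially. dist (h n) l < r / 2"
      using lim \<open>0 < r\<close> by (intro tendstoD) auto
    then obtain n where n: "norm (l - h n) < r / 2"
      by (auto simp: eventually_sequentially dist_norm norm_minus_commute)
    obtain e where e: "(e \<longlongrightarrow> 0) (time_limit J)" "\<And>t. 0 \<le> e t" "\<And>t. h n \<le> T t f + e t"
      using lb by (rule lower_boundE) blast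
    have "\<forall>\<^sub>F t in time_limit J. dist (e t) 0 < r / 2"
      using e(1) \<open>0 < r\<close> by (intro tendstoD) auto
    then show ?thesis
    proof eventually_elim
      case (elim t)
      have "l - T t f = (l - h n) + (h n - T t f)" by simp
      also have "\<dots> \<le> \<bar>l - h n\<bar> + e t"
        using e(3)[of t] by (intro add_mono abs_ge_self) (simp add: diff_le_eq add.commute)
      finally have "norm (pprt (l - T t f)) \<le> norm (\<bar>l - h n\<bar> + e t)"
        by (rule norm_pprt_le) (simp add: e(2))
      also have "\<dots> \<le> norm (l - h n) + norm (e t)"
        using norm_triangle_ineq[of "\<bar>l - h n\<bar>" "e t"] by (simp only: norm_abs_eq_norm)
      also have "\<dots> < r" using n elim by simp
      finally show ?case by (simp add: neg_part_def pprt_def)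
    qed
  qed
  then show ?thesis
    using \<open>0 \<le> l\<close> by (auto simp: lower_bound_def tendsto_iff)
qed

section \<open>Semigroups that admit non-zero lower bounds\<close>

locale bounded_positive_semigroup =
  fixes J :: "real set" and T :: "real \<Rightarrow> 'a::al_space \<Rightarrow>\<^sub>L 'a"
  assumes time: "time_domain J"
    and semigroup: "op_semigroup J T"
    and bounded: "bounded_family J T"
    and positive: "positive_family J T"
begin

lemma J_add:
  assumes "s \<in> J" and "t \<in> J"
  shows "s + t \<in> J"
  using time unfolding time_domain_def
proof
  assume J: "J = real ` {1..}"
  with assms obtain m n where "s = real m" "t = real n" "1 \<le> m" by auto
  then have "s + t = real (m + n)" and "m + n \<in> {1..}" by auto
  then show ?thesis unfolding J by (rule image_eqI)
qed (use assms in simp)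

lemma J_diff:
  assumes "s \<in> J" and "t \<in> J" and "s < t"
  shows "t - s \<in> J"
  using time unfolding time_domain_def
proof
  assume J: "J = real ` {1..}"
  with assms obtain m n where "s = real m" "t = real n" by blast
  with \<open>s < t\<close> have "t - s = real (n - m)" and "n - m \<in> {1..}" by auto
  then show ?thesis unfolding J by (rule image_eqI)
qed (use assms in simp)

lemma J_unbounded: "\<exists>t\<in>J. N \<le> t"
proof -
  obtain n where "N \<le> real n" using real_arch_simple by blast
  then show ?thesis using time
    by (auto simp: time_domain_def intro!: bexI[of _ "real (Suc n)"])
qed

lemma time_limit_nontrivial: "time_limit J \<noteq> bot"
  unfolding trivial_limit_def eventually_time_limit using J_unbounded by blast

lemma eventually_J: "\<forall>\<^sub>F t in time_limit J. t \<in> J"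
  by (auto simp: eventually_time_limit)

lemma T_add: "s \<in> J \<Longrightarrow> t \<in> J \<Longrightarrow> T (s + t) f = T s (T t f)"
  using semigroup by (simp add: op_semigroup_def)

lemma T_nonneg: "t \<in> J \<Longrightarrow> 0 \<le> f \<Longrightarrow> 0 \<le> T t f"
  using positive by (simp add: positive_family_def)

lemma T_mono: "t \<in> J \<Longrightarrow> f \<le> g \<Longrightarrow> T t f \<le> T t g"
  using T_nonneg[of t "g - f"] by (simp add: blinfun.diff_right)

text \<open>Applying \<open>T s\<close> to \<open>h \<le> T t f + e t\<close> gives \<open>T s h \<le> T (s + t) f + T s (e t)\<close>, and continuity of
  \<open>T s\<close> keeps the error small; only the time parameter is shifted by \<open>s\<close>.\<close>

lemma lower_bound_orbit:
  assumes lb: "lower_bound J T f h" and s: "s \<in> J"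
  shows "lower_bound J T f (T s h)"
proof -
  obtain e where e: "0 \<le> h" "(e \<longlongrightarrow> 0) (time_limit J)" "\<And>t. 0 \<le> e t" "\<And>t. h \<le> T t f + e t"
    using lb by (rule lower_boundE) blast
  have shift: "filterlim (\<lambda>t. t - s) (time_limit J) (time_limit J)"
    unfolding filterlim_iff
  proof (intro allI impI)
    fix Q assume "eventually Q (time_limit J)"
    then obtain N where N: "\<forall>t\<in>J. N \<le> t \<longrightarrow> Q t" by (auto simp: eventually_time_limit)
    have "Q (t - s)" if "t \<in> J" "max N 0 + s + 1 \<le> t" for t
      using N J_diff[OF s that(1)] that(2) by auto
    then show "\<forall>\<^sub>F t in time_limit J. Q (t - s)" by (auto simp: eventually_time_limit)
  qed
  show ?thesis
  proof (rule lower_boundI)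
    show "0 \<le> T s h" using s e(1) by (rule T_nonneg)
    have "((\<lambda>t. T s (e t)) \<longlongrightarrow> T s 0) (time_limit J)"
      using e(2) by (intro tendsto_intros)
    then show "((\<lambda>t. T s (e (t - s))) \<longlongrightarrow> 0) (time_limit J)"
      using filterlim_compose[OF _ shift] by simp
    show "\<forall>\<^sub>F t in time_limit J. 0 \<le> T s (e (t - s)) \<and> T s h \<le> T t f + T s (e (t - s))"
      unfolding eventually_time_limit
    proof (intro exI ballI impI conjI)
      fix t assume t: "t \<in> J" "s + 1 \<le> t"
      show "0 \<le> T s (e (t - s))" using s e(3) by (rule T_nonneg)
      have "T s h \<le> T s (T (t - s) f + e (t - s))" using s e(4) by (rule T_mono)
      also have "\<dots> = T t f + T s (e (t - s))"
        using T_add[OF s J_diff[OF s t(1)]] t(2) by (simp add: blinfun.add_right)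
      finally show "T s h \<le> T t f + T s (e (t - s))" .
    qed
  qed
qed

text \<open>At a time \<open>t\<close> where the error has norm below 1, the norm of a lower bound of \<open>f\<close> is at most
  \<open>norm (T t f) + 1\<close>. This time depends on the lower bound; boundedness of the semigroup gives an
  estimate that does not.\<close>

lemma lower_bounds_bdd: "bdd_above (norm ` {h. lower_bound J T f h})"
proof -
  obtain M where M: "\<And>t. t \<in> J \<Longrightarrow> norm (T t) \<le> M"
    using bounded by (auto simp: bounded_family_def bounded_iff)
  have "norm h \<le> M * norm f + 1" if lb: "lower_bound J T f h" for h
  proof -
    obtain e where e: "0 \<le> h" "(e \<longlongrightarrow> 0) (time_limit J)" "\<And>t. 0 \<le> e t" "\<And>t. h \<le> T t f + e t"
      using lb by (rule lower_boundE) blast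
    have "\<forall>\<^sub>F t in time_limit J. dist (e t) 0 < 1 \<and> t \<in> J"
      using tendstoD[OF e(2)] eventually_J by (intro eventually_conj) auto
    then obtain t where t: "norm (e t) < 1" "t \<in> J"
      using eventually_happens'[OF time_limit_nontrivial] by auto
    have "norm h \<le> norm (T t f + e t)" using e(1) e(4) by (rule norm_mono_positive)
    also have "\<dots> \<le> norm (T t f) + norm (e t)" by (rule norm_triangle_ineq)
    also have "norm (T t f) \<le> norm (T t) * norm f" by (rule norm_blinfun)
    also have "\<dots> \<le> M * norm f" using M[OF t(2)] by (rule mult_right_mono) simp
    finally show ?thesis using t(1) by simp
  qed
  then show ?thesis by (intro bdd_aboveI[of _ "M * norm f + 1"]) auto
qed

text \<open>A lower bound of a positive vector whose orbit tends to zero is itself zero, so the existence of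
  non-zero lower bounds excludes such orbits for non-zero positive vectors.\<close>

lemma vanishing_orbit_zero:
  assumes lbs: "\<forall>f>0. \<exists>h. h \<noteq> 0 \<and> lower_bound J T f h"
    and "0 \<le> f" and lim: "((\<lambda>t. T t f) \<longlongrightarrow> 0) (time_limit J)"
  shows "f = 0"
proof (rule ccontr)
  assume "f \<noteq> 0"
  with lbs \<open>0 \<le> f\<close> obtain h where "h \<noteq> 0" and lb: "lower_bound J T f h"
    by (metis order_le_less)
  obtain e where e: "0 \<le> h" "(e \<longlongrightarrow> 0) (time_limit J)" "\<And>t. h \<le> T t f + e t"
    using lb by (rule lower_boundE) blast
  have "((\<lambda>t. norm (T t f + e t)) \<longlongrightarrow> 0) (time_limit J)"
    using tendsto_norm_zero[OF tendsto_add[OF lim e(2), simplified]] .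
  then have "norm h \<le> 0"
    by (rule tendsto_lowerbound)
      (auto simp: time_limit_nontrivial intro: always_eventually norm_mono_positive e)
  with \<open>h \<noteq> 0\<close> show False by simp
qed

text \<open>The norms of a decreasing positive orbit converge, and \<open>T t (h - T s h)\<close> has norm
  \<open>norm (T t h) - norm (T (t + s) h)\<close>; thus the orbit of the positive vector \<open>h - T s h\<close> tends to
  zero.\<close>

lemma decreasing_orbit_fixed:
  assumes lbs: "\<forall>f>0. \<exists>h. h \<noteq> 0 \<and> lower_bound J T f h"
    and "0 \<le> h" and dec: "\<And>s. s \<in> J \<Longrightarrow> T s h \<le> h" and s: "s \<in> J"
  shows "T s h = h"
proof -
  define L where "L = Inf ((\<lambda>t. norm (T t h)) ` J)"
  have "J \<noteq> {}" using s by blast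
  have bdd: "bdd_below ((\<lambda>t. norm (T t h)) ` J)" by (rule bdd_belowI[of _ 0]) auto
  have L_le: "L \<le> norm (T t h)" if "t \<in> J" for t
    unfolding L_def using that bdd by (intro cInf_lower) auto
  have anti: "norm (T u h) \<le> norm (T t h)" if "t \<in> J" "u \<in> J" "t \<le> u" for t u
  proof (cases "t = u")
    case False
    then have d: "u - t \<in> J" using that by (intro J_diff) auto
    have "T u h = T t (T (u - t) h)" using T_add[OF that(1) d] by simp
    also have "\<dots> \<le> T t h" using that(1) dec[OF d] by (rule T_mono)
    finally show ?thesis using T_nonneg[OF that(2) \<open>0 \<le> h\<close>] by (intro norm_mono_positive)
  qed simp
  have "((\<lambda>t. T t (h - T s h)) \<longlongrightarrow> 0) (time_limit J)"
  proof (rule tendstoI)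
    fix r :: real assume "0 < r"
    then have "Inf ((\<lambda>t. norm (T t h)) ` J) < L + r" by (simp add: L_def)
    then obtain t0 where t0: "t0 \<in> J" "norm (T t0 h) < L + r"
      using cInf_less_iff[OF _ bdd] \<open>J \<noteq> {}\<close> by auto
    have "norm (T t (h - T s h)) < r" if t: "t \<in> J" "t0 \<le> t" for t
    proof -
      have "norm (T t (h - T s h)) = norm (T t h) - norm (T t (T s h))"
        unfolding blinfun.diff_right
        using T_nonneg[OF t(1) T_nonneg[OF s \<open>0 \<le> h\<close>]] T_mono[OF t(1) dec[OF s]]
        by (rule norm_diff_ordered)
      moreover have "L \<le> norm (T t (T s h))"
        using L_le[OF J_add[OF t(1) s]] T_add[OF t(1) s] by simp
      ultimately show ?thesis using t0(2) anti[OF t0(1) t] by linarith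
    qed
    then show "\<forall>\<^sub>F t in time_limit J. dist (T t (h - T s h)) 0 < r"
      by (auto simp: eventually_time_limit)
  qed
  then have "h - T s h = 0"
    using dec[OF s] by (intro vanishing_orbit_zero[OF lbs]) auto
  then show ?thesis by simp
qed

text \<open>Let \<open>h\<close> be the largest lower bound of \<open>f\<close>; it is fixed because its orbit consists of lower
  bounds and therefore stays below \<open>h\<close>. Since the operators commute with the lattice operations, the orbit of \<open>(f - h)\<^sup>-\<close> is
  \<open>(T t f - h)\<^sup>-\<close>, which tends to zero; hence \<open>h \<le> f\<close>. A non-zero lower bound \<open>k\<close> of the remainder
  \<open>f - h\<close> would make \<open>h + k\<close> a lower bound of \<open>f\<close> that exceeds \<open>h\<close>.\<close>

lemma lattice_hom_fixes_positive:
  assumes lbs: "\<forall>f>0. \<exists>h. h \<noteq> 0 \<and> lower_bound J T f h"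
    and hom: "\<forall>t\<in>J. lattice_hom (T t)"
    and "0 < f" and s: "s \<in> J"
  shows "T s f = f"
proof -
  let ?L = "{h. lower_bound J T f h}"
  have ne: "?L \<noteq> {}" using lbs \<open>0 < f\<close> by auto
  have nonneg: "0 \<le> k" if "k \<in> ?L" for k using that by (simp add: lower_bound_def)
  obtain h where "h \<in> ?L" and "\<And>k. k \<in> ?L \<Longrightarrow> k \<le> h"
    by (rule al_space_greatest_element[OF ne nonneg _ lower_bounds_bdd])
      (auto intro: lower_bound_sup lower_bound_tendsto)
  then have h: "lower_bound J T f h" and max: "\<And>k. lower_bound J T f k \<Longrightarrow> k \<le> h"
    by simp_all
  have "0 \<le> h" using h by (simp add: lower_bound_def)
  have fixed: "T t h = h" if "t \<in> J" for t
    using lbs \<open>0 \<le> h\<close> max[OF lower_bound_orbit[OF h]] that by (rule decreasing_orbit_fixed)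
  have orbit: "T t (neg_part (f - h)) = neg_part (T t f - h)" if "t \<in> J" for t
  proof -
    have "T t (sup (h - f) 0) = sup (T t (h - f)) (T t 0)"
      using hom that by (simp add: lattice_hom_def)
    then show ?thesis
      using fixed[OF that] by (simp add: neg_part_def blinfun.diff_right)
  qed
  have "((\<lambda>t. neg_part (T t f - h)) \<longlongrightarrow> 0) (time_limit J)"
    using h by (auto simp: lower_bound_def intro: tendsto_norm_zero_cancel)
  then have "((\<lambda>t. T t (neg_part (f - h))) \<longlongrightarrow> 0) (time_limit J)"
    by (rule Lim_transform_eventually)
      (use eventually_J in eventually_elim, simp add: orbit)
  then have "neg_part (f - h) = 0"
    by (intro vanishing_orbit_zero[OF lbs]) (simp_all add: neg_part_def)
  then have "h \<le> f"
    unfolding neg_part_def by (metis minus_diff_eq sup_ge1 diff_le_0_iff_le)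
  have "f = h"
  proof (rule ccontr)
    assume "f \<noteq> h"
    with \<open>h \<le> f\<close> have "0 < f - h" by simp
    then obtain k where "k \<noteq> 0" and k: "lower_bound J T (f - h) k" using lbs by blast
    obtain e where e: "0 \<le> k" "(e \<longlongrightarrow> 0) (time_limit J)" "\<And>t. 0 \<le> e t"
        "\<And>t. k \<le> T t (f - h) + e t"
      using k by (rule lower_boundE) blast
    have "lower_bound J T f (h + k)"
    proof (rule lower_boundI[OF _ e(2)])
      show "0 \<le> h + k" using \<open>0 \<le> h\<close> e(1) by simp
      show "\<forall>\<^sub>F t in time_limit J. 0 \<le> e t \<and> h + k \<le> T t f + e t"
        using eventually_J
      proof eventually_elim
        case (elim t)
        have "h + k \<le> h + (T t (f - h) + e t)" using e(4) by (rule add_left_mono)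
        also have "\<dots> = T t f + e t" using fixed[OF elim] by (simp add: blinfun.diff_right)
        finally show ?case using e(3) by simp
      qed
    qed
    then have "h + k \<le> h" by (rule max)
    with e(1) \<open>k \<noteq> 0\<close> show False by simp
  qed
  with fixed[OF s] show ?thesis by simp
qed

lemma lattice_hom_semigroup_trivial:
  assumes lbs: "\<forall>f>0. \<exists>h. h \<noteq> 0 \<and> lower_bound J T f h"
    and hom: "\<forall>t\<in>J. lattice_hom (T t)" and s: "s \<in> J"
  shows "T s = id_blinfun"
proof (rule blinfun_eqI)
  have pos: "T s g = g" if "0 \<le> g" for g
    using lattice_hom_fixes_positive[OF lbs hom _ s] that by (cases "g = 0") auto
  fix f
  have "T s f = T s (pprt f - (- nprt f))" by (simp flip: prts)
  also have "\<dots> = pprt f - (- nprt f)"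
    unfolding blinfun.diff_right by (simp only: pos zero_le_pprt neg_0_le_iff_le nprt_le_zero)
  also have "\<dots> = id_blinfun f" by (simp flip: prts)
  finally show "T s f = id_blinfun f" .
qed

end

theorem theorem5p5:
  fixes J :: "real set"
    and T :: "real \<Rightarrow> 'a::al_space \<Rightarrow>\<^sub>L 'a"
  assumes "time_domain J"
    and "op_semigroup J T"
    and "bounded_family J T"
    and "positive_family J T"
    and "\<forall>t\<in>J. lattice_hom (T t)"
  shows "((\<exists>P. converges_strongly J T P \<and> (\<forall>f>0. 0 < P f)) \<longleftrightarrow> (\<forall>t\<in>J. T t = id_blinfun))
       \<and> ((\<forall>t\<in>J. T t = id_blinfun) \<longleftrightarrow> (\<forall>f>0. \<exists>h. h \<noteq> 0 \<and> lower_bound J T f h))"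
    (is "(?conv \<longleftrightarrow> ?triv) \<and> (_ \<longleftrightarrow> ?lbs)")
proof -
  interpret bounded_positive_semigroup J T
    using assms by unfold_locales
  have "?triv \<Longrightarrow> ?conv"
  proof (intro exI conjI allI impI)
    assume triv: ?triv
    show "converges_strongly J T id_blinfun"
      unfolding converges_strongly_def
    proof
      fix f
      have "\<forall>\<^sub>F t in time_limit J. T t f = id_blinfun f"
        using eventually_J by eventually_elim (simp add: triv)
      then show "((\<lambda>t. T t f) \<longlongrightarrow> id_blinfun f) (time_limit J)"
        by (rule tendsto_eventually)
    qed
  qed simp
  moreover have "?conv \<Longrightarrow> ?lbs"
  proof (intro allI impI)
    fix f :: 'a
    assume ?conv and "0 < f"
    then obtain P where P: "((\<lambda>t. T t f) \<longlongrightarrow> P f) (time_limit J)" "0 < P f"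
      by (auto simp: converges_strongly_def)
    then have "lower_bound J T f (P f)" by (intro lower_bound_limit) auto
    with P(2) show "\<exists>h. h \<noteq> 0 \<and> lower_bound J T f h" by (intro exI[of _ "P f"]) auto
  qed
  moreover have "?lbs \<Longrightarrow> ?triv"
    using lattice_hom_semigroup_trivial assms(5) by blast
  ultimately show ?thesis by argo
qed

end
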